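(* Let $\alpha$ be badly approximable and let $(I_x)_{x\in\mathbb{N}}$ be a sequence of intervals, each of the form $I_x=[0,\rho_x]$ or $I_x=[1-\rho_x,1]$, contained in the unit interval, with $\lim_{x\to\infty}x\rho_x=\infty$. Let $$\mathcal{B}(x,I_x):=\{1\le n\le x: \{n\alpha\}\in I_x\}.$$ Then for every $d\in\mathbb{N}$ and every $a\in\mathbb{Z}/d\mathbb{Z}$, $$\lim_{x\to\infty}\frac{\#\{n\in\mathcal{B}(x,I_x): n\equiv a \pmod d\}}{\#\mathcal{B}(x,I_x)}=\frac1d .$$
   Context: $\{t\}$ denotes the fractional part of the real number $t$. An irrational $\alpha$ is badly approximable if $\liminf_{n\to\infty}n\|n\alpha\|>0$ (with $\|\cdot\|$ the distance to the nearest integer), equivalently if the partial quotients of its continued fraction expansion are bounded. In the set $\mathcal B(x,I_x)$, $n$ ranges over integers. *)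

theory Defs
  imports "HOL-Analysis.Analysis" "HOL-Number_Theory.Cong"
begin

text \<open>
  The distance from \<open>x\<close> to the nearest integer is \<open>infdist x \<int>\<close>. The limit inferior is
  taken in the extended reals, since \<open>real\<close> is not a complete lattice.
\<close>

definition badly_approximable :: "real \<Rightarrow> bool" where
  "badly_approximable \<alpha> \<longleftrightarrow>
     \<alpha> \<notin> \<rat> \<and> liminf (\<lambda>n. ereal (real n * infdist (real n * \<alpha>) \<int>)) > 0"

definition bohr_interval_set :: "real \<Rightarrow> nat \<Rightarrow> real set \<Rightarrow> int set" where
  "bohr_interval_set \<alpha> x J = {n. 1 \<le> n \<and> n \<le> int x \<and> frac (of_int n * \<alpha>) \<in> J}"

end

theory Submission
  imports Defs "HOL-Real_Asymp.Real_Asymp"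
begin

text \<open>
  Put \<open>T = \<surd>(x / \<rho>)\<close> and \<open>S = \<surd>(x \<rho>)\<close>. Since \<open>\<alpha>\<close> is badly approximable, every residue class
  modulo \<open>d\<close> contains some \<open>q \<ge> 0\<close> with \<open>q = O(T)\<close> whose multiple \<open>q \<alpha>\<close> is within \<open>O(1 / T)\<close> of an
  integer. Translating by such a \<open>q\<close> carries one residue class of the Bohr set into another, except
  for those \<open>n\<close> with \<open>n > x - q\<close> or with the fractional part of \<open>n \<alpha>\<close> within \<open>O(1 / T)\<close> of an endpoint
  of the interval. Since \<open>\<bar>n - n'\<bar> \<bar>{n \<alpha>} - {n' \<alpha>}\<bar> \<ge> c\<close> for \<open>n \<noteq> n'\<close>, there are only \<open>O(S)\<close> exceptions,
  so the classes differ in size by \<open>O(S)\<close>. The Bohr set itself has at least a constant times \<open>S\<^sup>2\<close>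
  elements: cut the rectangle of all \<open>(n, {n \<alpha>})\<close> into tiles of size \<open>O(T) \<times> O(1 / T)\<close>, each of which
  contains a point.
\<close>

section \<open>Bad approximability as a uniform Diophantine bound\<close>

text \<open>A single constant serves every nonzero \<open>q\<close> of either sign, so the bound
  applies directly to differences of integers. Ranging over all \<open>p\<close> replaces the
  distance to the nearest integer.\<close>

definition diophantine :: "real \<Rightarrow> real \<Rightarrow> bool" where
  "diophantine \<alpha> c \<longleftrightarrow>
     c > 0 \<and> (\<forall>q p :: int. q \<noteq> 0 \<longrightarrow> c \<le> \<bar>of_int q\<bar> * \<bar>of_int q * \<alpha> - of_int p\<bar>)"

lemma diophantineD:
  fixes q p :: int
  assumes "diophantine \<alpha> c" "q \<noteq> 0"
  shows "c \<le> \<bar>of_int q\<bar> * \<bar>of_int q * \<alpha> - of_int p\<bar>"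
  using assms by (simp add: diophantine_def)

lemma diophantine_pos: "diophantine \<alpha> c \<Longrightarrow> c > 0"
  by (simp add: diophantine_def)

lemma diophantine_not_Ints:
  assumes "diophantine \<alpha> c" "n \<noteq> (0::int)"
  shows "of_int n * \<alpha> \<notin> \<int>"
proof
  assume "of_int n * \<alpha> \<in> \<int>"
  then obtain p where "of_int n * \<alpha> = of_int p" by (elim Ints_cases)
  with diophantineD[OF assms, of p] diophantine_pos[OF assms(1)] show False by simp
qed

text \<open>The liminf bounds all but finitely many terms away from 0. Irrationality makes each
  remaining term positive, so the minimum of finitely many positive numbers works.\<close>

lemma badly_approximable_imp_diophantine:
  assumes "badly_approximable \<alpha>"
  obtains c where "diophantine \<alpha> c"
proof -
  define f where "f n = real n * infdist (real n * \<alpha>) \<int>" for n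
  have irr: "\<alpha> \<notin> \<rat>" and lim: "liminf (\<lambda>n. ereal (f n)) > 0"
    using assms by (auto simp: badly_approximable_def f_def)
  obtain e where e: "e > 0" "ereal e < liminf (\<lambda>n. ereal (f n))"
    using ereal_dense2[OF lim] by auto
  obtain N where N: "\<And>n. n \<ge> N \<Longrightarrow> e < f n"
    using less_LiminfD[OF e(2)] unfolding eventually_sequentially by auto
  have pos: "f n > 0" if "n \<ge> 1" for n
  proof -
    have "real n * \<alpha> \<notin> \<int>"
    proof
      assume "real n * \<alpha> \<in> \<int>"
      then have "real n * \<alpha> / real n \<in> \<rat>"
        by (meson Ints_subset_Rats Rats_divide Rats_of_nat subsetD)
      with irr that show False by simp
    qed
    moreover have "closed (\<int> :: real set)" "(\<int> :: real set) \<noteq> {}" using closed_Ints by auto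
    ultimately have "infdist (real n * \<alpha>) \<int> \<noteq> 0"
      using in_closed_iff_infdist_zero by blast
    then show ?thesis using infdist_nonneg[of "real n * \<alpha>" \<int>] that by (simp add: f_def)
  qed
  define c where "c = Min (insert e (f ` {1..N}))"
  have c: "c > 0" using e pos by (auto simp: c_def)
  have cf: "c \<le> f n" if "n \<ge> 1" for n
  proof (cases "n \<le> N")
    case True
    then show ?thesis unfolding c_def using that by (intro Min_le) auto
  next
    case False
    then have "e < f n" using N by simp
    moreover have "c \<le> e" by (auto simp: c_def intro!: Min_le)
    ultimately show ?thesis by simp
  qed
  have "c \<le> \<bar>of_int q\<bar> * \<bar>of_int q * \<alpha> - of_int p\<bar>" if "q \<noteq> 0" for q p :: int
  proof -
    define n where "n = nat \<bar>q\<bar>"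
    have n: "n \<ge> 1" "real n = \<bar>of_int q\<bar>" using that by (auto simp: n_def)
    \<comment> \<open>The sign is moved onto \<open>p\<close> because \<open>f\<close> only sees
      positive integers.\<close>
    have "f n \<le> real n * dist (real n * \<alpha>) (of_int (sgn q * p))"
      unfolding f_def by (intro mult_left_mono infdist_le) auto
    also have "dist (real n * \<alpha>) (of_int (sgn q * p)) = \<bar>of_int q * \<alpha> - of_int p\<bar>"
      using that unfolding n by (cases "q > 0") (auto simp: dist_real_def)
    finally show ?thesis using cf[OF n(1)] n by simp
  qed
  with c have "diophantine \<alpha> c" by (simp add: diophantine_def)
  then show ?thesis by (rule that)
qed

lemma diophantine_mult_nat:
  assumes "diophantine \<alpha> c" "d \<ge> (1::nat)"
  shows "diophantine (real d * \<alpha>) (c / real d)"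
  unfolding diophantine_def
proof (intro conjI allI impI)
  show "c / real d > 0" using assms diophantine_pos by simp
  fix q p :: int assume "q \<noteq> 0"
  then have "c \<le> \<bar>of_int (q * int d)\<bar> * \<bar>of_int (q * int d) * \<alpha> - of_int p\<bar>"
    using assms by (intro diophantineD) auto
  then show "c / real d \<le> \<bar>of_int q\<bar> * \<bar>of_int q * (real d * \<alpha>) - of_int p\<bar>"
    using assms(2) by (simp add: field_simps abs_mult)
qed

section \<open>Separated points and inhomogeneous approximation\<close>

text \<open>Pigeonhole: each half-open cell of length \<open>s\<close> contains at most one value of
  \<open>f\<close>.\<close>

lemma card_separated:
  fixes f :: "'a \<Rightarrow> real"
  assumes "s > 0" "f ` A \<subseteq> {y..y + h}" "h \<ge> 0"
    and sep: "\<And>a b. a \<in> A \<Longrightarrow> b \<in> A \<Longrightarrow> a \<noteq> b \<Longrightarrow> s \<le> \<bar>f a - f b\<bar>"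
  shows "real (card A) \<le> h / s + 1"
proof -
  define g where "g a = \<lfloor>(f a - y) / s\<rfloor>" for a
  have "inj_on g A"
  proof (rule inj_onI, rule ccontr)
    fix a b assume ab: "a \<in> A" "b \<in> A" "g a = g b" "a \<noteq> b"
    have "\<bar>(f a - y) / s - (f b - y) / s\<bar> < 1"
      using ab(3) unfolding g_def by linarith
    moreover have "(f a - y) / s - (f b - y) / s = (f a - f b) / s"
      by (simp add: diff_divide_distrib)
    ultimately have "\<bar>f a - f b\<bar> < s" using assms(1) by (simp add: abs_divide)
    with sep[OF ab(1,2,4)] show False by simp
  qed
  moreover have "g ` A \<subseteq> {0..\<lfloor>h / s\<rfloor>}"
  proof (rule image_subsetI)
    fix a assume "a \<in> A"
    then have "y \<le> f a" "f a \<le> y + h" using assms(2) by auto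
    then show "g a \<in> {0..\<lfloor>h / s\<rfloor>}"
      using assms(1) by (auto simp: g_def intro!: floor_mono divide_right_mono)
  qed
  ultimately have "card A \<le> card {0..\<lfloor>h / s\<rfloor>}"
    by (intro card_inj_on_le) auto
  moreover have "0 \<le> h / s" using assms by simp
  ultimately show ?thesis by (simp, linarith)
qed

lemma frac_eq_if_close:
  assumes "x - of_int m = y" "0 \<le> y" "y \<le> 1" "x \<notin> \<int>"
  shows "frac x = y"
proof -
  have "x = of_int (m + 1)" if "y = 1" using assms(1) that by simp
  then have "y \<noteq> 1" using assms(4) Ints_of_int by metis
  moreover have "x - y = of_int m" using assms(1) by simp
  then have "x - y \<in> \<int>" by simp
  ultimately show ?thesis using assms unfolding frac_unique_iff by simp
qed

text \<open>Dirichlet's theorem gives \<open>p / q\<close> close to \<open>\<beta>\<close> with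
  \<open>q\<close> at most \<open>T\<close>, and the Diophantine bound forces \<open>q\<close> to be
  of order \<open>T\<close>. The multiples of \<open>p / q\<close> modulo 1 are then a grid of mesh
  \<open>O(1 / T)\<close>.\<close>

lemma inhomogeneous_approximation:
  assumes "diophantine \<beta> c" "T \<ge> 1"
  obtains k m :: int where "0 \<le> k" "of_int k \<le> T"
    "\<bar>of_int k * \<beta> - \<gamma> - of_int m\<bar> \<le> (2 + 1 / c) / T"
proof -
  have c: "c > 0" using assms diophantine_pos by blast
  define N where "N = nat \<lfloor>T\<rfloor>"
  have N: "N > 0" "real N \<le> T" "T < real N + 1"
    using assms(2) unfolding N_def by linarith+
  then have T_le: "T \<le> 2 * real N" by linarith
  obtain p q where pq: "coprime p q" "0 < q" "q \<le> int N"
      and appr: "\<bar>of_int q * \<beta> - of_int p\<bar> < 1 / N"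
    using Dirichlet_approx_coprime[OF N(1)] by blast
  have "c \<le> \<bar>of_int q\<bar> * \<bar>of_int q * \<beta> - of_int p\<bar>"
    using assms(1) pq by (intro diophantineD) auto
  also have "\<dots> \<le> of_int q * (1 / N)"
    using appr pq by (intro mult_mono) auto
  finally have q_ge: "c * N \<le> of_int q" using N by (simp add: field_simps)
  obtain t where t: "[p * t = 1] (mod q)"
    using cong_solve_coprime_int pq(1) by blast
  \<comment> \<open>As \<open>k\<close> runs through the residues modulo \<open>q\<close>, so does \<open>p * k\<close>; choose \<open>k\<close> such that
    \<open>k * p / q\<close> is modulo 1 the fraction with denominator \<open>q\<close> closest to \<open>\<gamma>\<close>.\<close>
  define w where "w = round (\<gamma> * of_int q)"
  define k where "k = (t * w) mod q"
  have k: "0 \<le> k" "k < q" using pq by (auto simp: k_def)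
  have "[p * k = p * (t * w)] (mod q)" unfolding k_def by (intro cong_mult) auto
  also have "p * (t * w) = (p * t) * w" by simp
  also have "[(p * t) * w = 1 * w] (mod q)" using t by (intro cong_mult) auto
  finally obtain m where m: "p * k = w + q * m"
    by (metis mult_1 cong_iff_lin cong_sym)
  have w: "\<bar>of_int w - \<gamma> * of_int q\<bar> \<le> 1 / 2"
    unfolding w_def by (rule of_int_round_abs_le)
  have "of_int p * of_int k = of_int w + of_int q * (of_int m :: real)"
    using m by (metis of_int_add of_int_mult)
  \<comment> \<open>Two errors: replacing \<open>\<beta>\<close> by \<open>p / q\<close> costs at
    most \<open>1 / N\<close> because \<open>k < q\<close>; rounding \<open>\<gamma>\<close> to the
    grid costs at most \<open>1 / (2 * q)\<close>.\<close>
  then have "of_int k * \<beta> - \<gamma> - of_int m =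
      of_int k / of_int q * (of_int q * \<beta> - of_int p) + (of_int w - \<gamma> * of_int q) / of_int q"
    using pq(2) by (simp add: field_simps)
  also have "\<bar>\<dots>\<bar> \<le> \<bar>of_int k / of_int q * (of_int q * \<beta> - of_int p)\<bar>
      + \<bar>(of_int w - \<gamma> * of_int q) / of_int q\<bar>"
    by (rule abs_triangle_ineq)
  also have "\<bar>of_int k / of_int q * (of_int q * \<beta> - of_int p)\<bar> \<le> 1 * (1 / N)"
    unfolding abs_mult using k pq appr by (intro mult_mono) auto
  also have "\<bar>(of_int w - \<gamma> * of_int q) / of_int q\<bar> \<le> (1 / 2) / (c * N)"
    unfolding abs_divide using w q_ge pq(2) c N by (intro frac_le) auto
  also have "1 * (1 / N) + (1 / 2) / (c * N) = (2 + 1 / c) / (2 * N)"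
    using c N by (simp add: field_simps)
  also have "\<dots> \<le> (2 + 1 / c) / T"
    using N T_le assms c by (intro divide_left_mono) auto
  finally have "\<bar>of_int k * \<beta> - \<gamma> - of_int m\<bar> \<le> (2 + 1 / c) / T" by simp
  moreover have "of_int k \<le> T" using k pq N by linarith
  ultimately show ?thesis using that k by blast
qed

section \<open>Upper bounds for thin pieces of the Bohr set\<close>

lemma finite_bohr_interval_set: "finite (bohr_interval_set \<alpha> x J)"
  by (rule finite_subset[of _ "{1..int x}"]) (auto simp: bohr_interval_set_def)

lemma frac_diff_ge:
  assumes "diophantine \<alpha> c" "n \<noteq> n'"
  shows "c \<le> \<bar>of_int (n - n')\<bar> * \<bar>frac (of_int n * \<alpha>) - frac (of_int n' * \<alpha>)\<bar>"
proof -
  have "frac (of_int n * \<alpha>) - frac (of_int n' * \<alpha>) =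
      of_int (n - n') * \<alpha> - of_int (\<lfloor>of_int n * \<alpha>\<rfloor> - \<lfloor>of_int n' * \<alpha>\<rfloor>)"
    by (simp add: frac_def algebra_simps)
  with diophantineD[OF assms(1)] assms(2) show ?thesis by (metis eq_iff_diff_eq_0)
qed

text \<open>Fractional parts within \<open>h\<close> of each other force distinct integers to be at
  least \<open>c / h\<close> apart.\<close>

lemma card_bohr_interval_set_le:
  assumes "diophantine \<alpha> c" "h > 0"
  shows "real (card (bohr_interval_set \<alpha> x {v..v + h})) \<le> real x * h / c + 1"
proof -
  have c: "c > 0" using assms diophantine_pos by blast
  have "real (card (bohr_interval_set \<alpha> x {v..v + h})) \<le> real x / (c / h) + 1"
  proof (rule card_separated[where f = of_int and y = 0])
    show "of_int ` bohr_interval_set \<alpha> x {v..v + h} \<subseteq> {0..0 + real x}"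
      by (auto simp: bohr_interval_set_def)
    fix n n' assume n: "n \<in> bohr_interval_set \<alpha> x {v..v + h}"
      "n' \<in> bohr_interval_set \<alpha> x {v..v + h}" "n \<noteq> n'"
    have "c \<le> \<bar>of_int (n - n')\<bar> * \<bar>frac (of_int n * \<alpha>) - frac (of_int n' * \<alpha>)\<bar>"
      by (rule frac_diff_ge[OF assms(1) n(3)])
    also have "\<dots> \<le> \<bar>of_int (n - n')\<bar> * h"
      using n by (intro mult_left_mono) (auto simp: bohr_interval_set_def)
    finally show "c / h \<le> \<bar>of_int n - of_int n'\<bar>" using assms by (simp add: field_simps)
  qed (use c assms in auto)
  then show ?thesis by simp
qed

text \<open>The dual count: integers less than \<open>Q\<close> apart have fractional parts at least
  \<open>c / Q\<close> apart.\<close>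

lemma card_bohr_interval_set_window_le:
  assumes "diophantine \<alpha> c" "Q > 0" "\<rho> \<ge> 0"
  shows "real (card {n \<in> bohr_interval_set \<alpha> x {u..u + \<rho>}. real x - Q < of_int n})
    \<le> \<rho> * Q / c + 1"
proof -
  let ?A = "{n \<in> bohr_interval_set \<alpha> x {u..u + \<rho>}. real x - Q < of_int n}"
  have c: "c > 0" using assms diophantine_pos by blast
  have "real (card ?A) \<le> \<rho> / (c / Q) + 1"
  proof (rule card_separated[where f = "\<lambda>n. frac (of_int n * \<alpha>)" and y = u])
    fix n n' assume n: "n \<in> ?A" "n' \<in> ?A" "n \<noteq> n'"
    have "c \<le> \<bar>of_int (n - n')\<bar> * \<bar>frac (of_int n * \<alpha>) - frac (of_int n' * \<alpha>)\<bar>"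
      by (rule frac_diff_ge[OF assms(1) n(3)])
    also have "\<dots> \<le> Q * \<bar>frac (of_int n * \<alpha>) - frac (of_int n' * \<alpha>)\<bar>"
    proof (intro mult_right_mono)
      have "real_of_int n \<le> real x" "real_of_int n' \<le> real x"
        using n by (auto simp: bohr_interval_set_def)
      then show "\<bar>of_int (n - n')\<bar> \<le> Q" using n by auto
    qed auto
    finally show "c / Q \<le> \<bar>frac (of_int n * \<alpha>) - frac (of_int n' * \<alpha>)\<bar>"
      using assms by (simp add: field_simps)
  qed (use c assms in \<open>auto simp: bohr_interval_set_def\<close>)
  then show ?thesis by simp
qed

section \<open>Comparison of residue classes by translation\<close>

lemma card_residue_class_shift:
  fixes q p :: int
  assumes dio: "diophantine \<alpha> c" and u: "0 \<le> u" "u + \<rho> \<le> 1" "\<rho> \<ge> 0"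
    and q: "0 \<le> q" "of_int q \<le> Q" "Q > 0" "[a + q = b] (mod int d)"
    and h: "\<bar>of_int q * \<alpha> - of_int p\<bar> \<le> h" "h > 0"
  shows "real (card {n \<in> bohr_interval_set \<alpha> x {u..u + \<rho>}. [n = a] (mod int d)})
    \<le> real (card {n \<in> bohr_interval_set \<alpha> x {u..u + \<rho>}. [n = b] (mod int d)})
      + (\<rho> * Q / c + 2 * real x * h / c + 3)"
proof -
  let ?S = "bohr_interval_set \<alpha> x {u..u + \<rho>}"
  let ?A = "{n \<in> ?S. [n = a] (mod int d)}"
  let ?B = "{n \<in> ?S. [n = b] (mod int d)}"
  define E1 where "E1 = {n \<in> ?S. real x - Q < of_int n}"
  define E2 where "E2 = bohr_interval_set \<alpha> x {u..u + h}"
  \<comment> \<open>For large \<open>h\<close> the strips \<open>E2\<close> and \<open>E3\<close>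
    may stick out of the interval. This is harmless, as only upper bounds for their sizes are
    needed.\<close>
  define E3 where "E3 = bohr_interval_set \<alpha> x {u + \<rho> - h..(u + \<rho> - h) + h}"
  have fin: "finite E1" "finite E2" "finite E3" "finite ?A" "finite ?B"
    by (auto simp: E1_def E2_def E3_def finite_bohr_interval_set)
  have sub: "(\<lambda>n. n + q) ` (?A - (E1 \<union> E2 \<union> E3)) \<subseteq> ?B"
  proof (rule image_subsetI)
    fix n assume n: "n \<in> ?A - (E1 \<union> E2 \<union> E3)"
    define y where "y = frac (of_int n * \<alpha>)"
    have n1: "1 \<le> n" "n \<le> int x" "u \<le> y" "y \<le> u + \<rho>" "[n = a] (mod int d)"
      using n by (auto simp: bohr_interval_set_def y_def)
    have nE: "of_int n \<le> real x - Q" "u + h < y" "y < u + \<rho> - h"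
      using n n1 by (auto simp: bohr_interval_set_def y_def E1_def E2_def E3_def)
    have le: "n + q \<le> int x" using nE(1) q(2) by linarith
    have "frac (of_int (n + q) * \<alpha>) = y + (of_int q * \<alpha> - of_int p)"
    proof (rule frac_eq_if_close)
      show "of_int (n + q) * \<alpha> - of_int (\<lfloor>of_int n * \<alpha>\<rfloor> + p) = y + (of_int q * \<alpha> - of_int p)"
        by (simp add: y_def frac_def algebra_simps)
      show "0 \<le> y + (of_int q * \<alpha> - of_int p)" "y + (of_int q * \<alpha> - of_int p) \<le> 1"
        using nE h u by linarith+
      show "of_int (n + q) * \<alpha> \<notin> \<int>"
        using n1 q by (intro diophantine_not_Ints[OF dio]) auto
    qed
    moreover have "u \<le> y + (of_int q * \<alpha> - of_int p)"
      "y + (of_int q * \<alpha> - of_int p) \<le> u + \<rho>" using nE h by linarith+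
    moreover have "[n + q = b] (mod int d)"
      using cong_trans[OF cong_add[OF n1(5) cong_refl] q(4)] .
    ultimately show "n + q \<in> ?B"
      using le n1 q by (simp add: bohr_interval_set_def)
  qed
  have "card ?A \<le> card ((?A - (E1 \<union> E2 \<union> E3)) \<union> (E1 \<union> E2 \<union> E3))"
    using fin by (intro card_mono) auto
  also have "\<dots> \<le> card (?A - (E1 \<union> E2 \<union> E3)) + card (E1 \<union> E2 \<union> E3)"
    by (rule card_Un_le)
  also have "card (?A - (E1 \<union> E2 \<union> E3)) \<le> card ?B"
    using sub fin by (intro card_inj_on_le) (auto intro: inj_onI)
  also have "card (E1 \<union> E2 \<union> E3) \<le> card E1 + card E2 + card E3"
    by (meson add_le_mono1 card_Un_le order_trans)
  finally have "real (card ?A) \<le> real (card ?B) + (real (card E1) + real (card E2) + real (card E3))"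
    by linarith
  moreover have "real (card E1) \<le> \<rho> * Q / c + 1"
    unfolding E1_def by (rule card_bohr_interval_set_window_le[OF dio q(3) u(3)])
  moreover have "real (card E2) \<le> real x * h / c + 1" "real (card E3) \<le> real x * h / c + 1"
    unfolding E2_def E3_def by (rule card_bohr_interval_set_le[OF dio h(2)])+
  ultimately show ?thesis by simp
qed

lemma card_residue_class_diff_le:
  assumes "diophantine \<alpha> c" "d \<ge> 1" "0 \<le> u" "u + \<rho> \<le> 1" "\<rho> > 0" "x \<ge> 1"
  shows "real (card {n \<in> bohr_interval_set \<alpha> x {u..u + \<rho>}. [n = a] (mod int d)})
    \<le> real (card {n \<in> bohr_interval_set \<alpha> x {u..u + \<rho>}. [n = b] (mod int d)})
      + ((2 * d + 2 * (2 + d / c)) / c * sqrt (x * \<rho>) + 3)"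
proof -
  have c: "c > 0" using assms diophantine_pos by blast
  \<comment> \<open>This choice balances the two kinds of exceptions: \<open>\<rho> * T\<close> and
    \<open>x / T\<close> both equal \<open>sqrt (x * \<rho>)\<close>.\<close>
  define T where "T = sqrt (real x / \<rho>)"
  have "\<rho> * 1 \<le> 1 * real x" using assms by (intro mult_mono) auto
  then have T: "T \<ge> 1" using assms(5) by (simp add: T_def field_simps)
  have T1: "real x / T = sqrt (x * \<rho>)" "\<rho> * T = sqrt (x * \<rho>)"
    using assms(5,6) by (simp_all add: T_def real_sqrt_divide real_sqrt_mult field_simps)
  define C where "C = 2 + real d / c"
  have C: "C > 0" using c by (simp add: C_def add_pos_nonneg)
  have dio: "diophantine (real d * \<alpha>) (c / d)"
    by (rule diophantine_mult_nat[OF assms(1,2)])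
  define r where "r = (b - a) mod int d"
  have r: "0 \<le> r" "r < int d" using assms(2) by (auto simp: r_def)
  \<comment> \<open>The shift \<open>r + d * k\<close> has the prescribed residue \<open>r\<close>; making its multiple of \<open>\<alpha>\<close> nearly integral
    is an inhomogeneous problem for \<open>d * \<alpha>\<close> with target \<open>- r * \<alpha>\<close>.\<close>
  obtain k m where k: "0 \<le> k" "of_int k \<le> T"
    and km: "\<bar>of_int k * (real d * \<alpha>) - (- of_int r * \<alpha>) - of_int m\<bar> \<le> (2 + 1 / (c / d)) / T"
    by (rule inhomogeneous_approximation[OF dio T])
  define q where "q = r + int d * k"
  have "real_of_int q \<le> 2 * d * T"
  proof -
    have "real_of_int r \<le> d * 1" using r by linarith
    also have "\<dots> \<le> real d * T" using T assms(2) by simp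
    finally have "real_of_int r \<le> d * T" .
    moreover have "d * real_of_int k \<le> d * T" using k by (intro mult_left_mono) auto
    ultimately show ?thesis by (simp add: q_def)
  qed
  moreover have "\<bar>of_int q * \<alpha> - of_int m\<bar> \<le> C / T"
    using km by (simp add: q_def C_def algebra_simps)
  moreover have "[a + q = b] (mod int d)"
  proof -
    have "a + q - b = int d * (k - (b - a) div int d)"
      unfolding q_def r_def minus_div_mult_eq_mod[symmetric] by (simp add: algebra_simps)
    then show ?thesis by (simp add: cong_iff_dvd_diff)
  qed
  moreover have "0 \<le> q" using r k by (simp add: q_def)
  ultimately have "real (card {n \<in> bohr_interval_set \<alpha> x {u..u + \<rho>}. [n = a] (mod int d)})
    \<le> real (card {n \<in> bohr_interval_set \<alpha> x {u..u + \<rho>}. [n = b] (mod int d)})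
      + (\<rho> * (2 * d * T) / c + 2 * real x * (C / T) / c + 3)"
    using assms C T by (intro card_residue_class_shift[where q = q and p = m]) auto
  also have "\<rho> * (2 * d * T) / c + 2 * real x * (C / T) / c
      = (2 * d * (\<rho> * T) + 2 * C * (real x / T)) / c"
    by (simp add: add_divide_distrib algebra_simps)
  also have "\<dots> = (2 * d + 2 * C) / c * sqrt (x * \<rho>)"
    unfolding T1 by (simp add: algebra_simps)
  finally show ?thesis by (simp add: C_def)
qed

section \<open>Lower bound for the size of the Bohr set\<close>

lemma card_bohr_interval_set_ge:
  assumes "diophantine \<alpha> c" "0 \<le> u" "u + \<rho> \<le> 1" "\<rho> > 0" "x \<ge> 1"
    and "sqrt (x * \<rho>) \<ge> 2" "sqrt (x * \<rho>) \<ge> 3 * (2 + 1 / c)"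
  shows "real (card (bohr_interval_set \<alpha> x {u..u + \<rho>}))
    \<ge> (sqrt (x * \<rho>) / 2 - 1) * (sqrt (x * \<rho>) / (3 * (2 + 1 / c)) - 1)"
proof -
  let ?S = "bohr_interval_set \<alpha> x {u..u + \<rho>}"
  have c: "c > 0" using assms diophantine_pos by blast
  define T where "T = sqrt (real x / \<rho>)"
  have "\<rho> * 1 \<le> 1 * real x" using assms by (intro mult_mono) auto
  then have T: "T \<ge> 1" using assms(4) by (simp add: T_def field_simps)
  have T1: "real x / T = sqrt (x * \<rho>)" "\<rho> * T = sqrt (x * \<rho>)"
    using assms(4,5) by (simp_all add: T_def real_sqrt_divide real_sqrt_mult field_simps)
  define C where "C = 2 + 1 / c"
  have C: "C > 0" using c by (simp add: C_def add_pos_nonneg)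
  define h where "h = C / T"
  have h: "h > 0" using C T by (simp add: h_def)
  \<comment> \<open>A column of width \<open>M\<close> has room for every shift \<open>k\<close> in
    \<open>{0..T}\<close>, since \<open>M\<close> exceeds \<open>T\<close>.\<close>
  define M where "M = \<lfloor>T\<rfloor> + 1"
  have M: "M > 0" "T < of_int M" "of_int M \<le> 2 * T" using T unfolding M_def by linarith+
  define A where "A = \<lfloor>real x / of_int M\<rfloor>"
  \<comment> \<open>Vertical spacing \<open>3 * h\<close> exceeds the tile height \<open>2 * h\<close>, which keeps the closed tiles disjoint.\<close>
  define B where "B = \<lfloor>\<rho> / (3 * h)\<rfloor>"
  have A: "of_int A * of_int M \<le> real x"
    using M by (simp add: A_def flip: pos_le_divide_eq)
  have B: "of_int B * (3 * h) \<le> \<rho>"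
    using h by (simp add: B_def flip: pos_le_divide_eq)
  \<comment> \<open>Tile \<open>(i, j)\<close> starts at the integer \<open>i * M + 1\<close>, which
    is positive, and is centred at height \<open>u + (3 * j + 1) * h\<close>. It thus spans the
    heights from \<open>u + 3 * j * h\<close> to \<open>u + (3 * j + 2) * h\<close>, and lies below
    \<open>u + \<rho>\<close> when \<open>j < B\<close>.\<close>
  define close where "close i j k m \<longleftrightarrow> 0 \<le> k \<and> of_int k \<le> T \<and>
      \<bar>of_int k * \<alpha> - (u + (3 * of_int j + 1) * h - of_int (i * M + 1) * \<alpha>) - of_int m\<bar> \<le> h"
    for i j k m :: int
  have "\<exists>k m. close i j k m" for i j
    using inhomogeneous_approximation[OF assms(1) T] unfolding close_def h_def C_def by blast
  then obtain k m where "\<And>i j. close i j (k i j) (m i j)" by metis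
  then have k: "\<And>i j. 0 \<le> k i j" "\<And>i j. of_int (k i j) \<le> T"
    and km: "\<And>i j. \<bar>of_int (k i j) * \<alpha> - (u + (3 * of_int j + 1) * h - of_int (i * M + 1) * \<alpha>)
      - of_int (m i j)\<bar> \<le> h"
    by (auto simp: close_def)
  define P where "P = (\<lambda>(i, j). i * M + 1 + k i j)"
  have kM: "k i j < M" for i j using k[of i j] M by linarith
  have fracP: "\<bar>frac (of_int (P (i, j)) * \<alpha>) - (u + (3 * of_int j + 1) * h)\<bar> \<le> h"
    and P_in: "P (i, j) \<in> ?S" if ij: "i \<in> {0..<A}" "j \<in> {0..<B}" for i j
  proof -
    define y where "y = of_int (P (i, j)) * \<alpha> - of_int (m i j)"
    have y: "\<bar>y - (u + (3 * of_int j + 1) * h)\<bar> \<le> h"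
      using km[of i j] by (simp add: y_def P_def algebra_simps)
    have "(of_int j + 1) * (3 * h) \<le> of_int B * (3 * h)"
      using ij h by (intro mult_right_mono) auto
    then have "(of_int j + 1) * (3 * h) \<le> \<rho>" using B by linarith
    moreover have "0 \<le> of_int j * h" using ij h by simp
    ultimately have yu: "u \<le> y" "y \<le> u + \<rho>"
      using y h by (auto simp: algebra_simps)
    have "0 \<le> i * M" using ij M by simp
    then have P1: "1 \<le> P (i, j)" using k(1)[of i j] by (simp add: P_def)
    have "(i + 1) * M \<le> A * M" using ij M by (intro mult_right_mono) auto
    moreover have "A * M \<le> int x" using A
      by (metis of_int_le_iff of_int_mult of_int_of_nat_eq)
    ultimately have P2: "P (i, j) \<le> int x" using kM[of i j] by (simp add: P_def algebra_simps)
    have fr: "frac (of_int (P (i, j)) * \<alpha>) = y"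
    proof (rule frac_eq_if_close)
      show "of_int (P (i, j)) * \<alpha> \<notin> \<int>"
        using P1 by (intro diophantine_not_Ints[OF assms(1)]) auto
    qed (use yu assms in \<open>auto simp: y_def\<close>)
    show "\<bar>frac (of_int (P (i, j)) * \<alpha>) - (u + (3 * of_int j + 1) * h)\<bar> \<le> h"
      unfolding fr by (rule y)
    show "P (i, j) \<in> ?S"
      using P1 P2 fr yu by (simp add: bohr_interval_set_def)
  qed
  have "inj_on P ({0..<A} \<times> {0..<B})"
  proof (rule inj_onI)
    fix z z' assume "z \<in> {0..<A} \<times> {0..<B}" "z' \<in> {0..<A} \<times> {0..<B}" and eq: "P z = P z'"
    then obtain i j i' j' where z: "z = (i, j)" "z' = (i', j')"
      "i \<in> {0..<A}" "j \<in> {0..<B}" "i' \<in> {0..<A}" "j' \<in> {0..<B}" by auto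
    \<comment> \<open>The column is recovered by division, as \<open>k i j\<close> is a remainder
      modulo \<open>M\<close>.\<close>
    have div: "(P (i, j) - 1) div M = i" for i j
      using k(1)[of i j] kM[of i j] by (simp add: P_def)
    have "i = i'" using div[of i j] div[of i' j'] eq z by simp
    \<comment> \<open>A common point puts the two centres within \<open>2 * h\<close>, while
      distinct rows have centres at least \<open>3 * h\<close> apart.\<close>
    have "\<bar>(u + (3 * of_int j + 1) * h) - (u + (3 * of_int j' + 1) * h)\<bar> \<le> 2 * h"
      using fracP[OF z(3,4)] fracP[OF z(5,6), folded eq[unfolded z(1,2)]] by linarith
    also have "(u + (3 * of_int j + 1) * h) - (u + (3 * of_int j' + 1) * h)
        = (3 * (of_int j - of_int j')) * h" by (simp add: algebra_simps)
    finally have "3 * \<bar>real_of_int j - of_int j'\<bar> * h \<le> 2 * h" using h by (simp add: abs_mult)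
    then have "3 * \<bar>real_of_int j - of_int j'\<bar> \<le> 2" using h by simp
    then have "\<bar>real_of_int (j - j')\<bar> < 1" by simp
    then have "j = j'" by linarith
    with \<open>i = i'\<close> z show "z = z'" by simp
  qed
  then have "card ({0..<A} \<times> {0..<B}) \<le> card ?S"
    using P_in by (intro card_inj_on_le finite_bohr_interval_set) auto
  then have card: "nat A * nat B \<le> card ?S" by (simp add: card_cartesian_product)
  have "sqrt (x * \<rho>) / 2 = real x / (2 * T)" using T1(1) by (metis divide_divide_eq_left mult.commute)
  also have "\<dots> \<le> real x / of_int M" using M by (intro divide_left_mono) auto
  also have "\<dots> \<le> real (nat A) + 1" unfolding A_def by linarith
  finally have A': "sqrt (x * \<rho>) / 2 - 1 \<le> nat A" by simp
  have "sqrt (x * \<rho>) / (3 * C) = \<rho> / (3 * h)"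
    unfolding h_def T1(2)[symmetric] using T by simp
  also have "\<dots> \<le> real (nat B) + 1" unfolding B_def by linarith
  finally have B': "sqrt (x * \<rho>) / (3 * C) - 1 \<le> nat B" by simp
  have "(sqrt (x * \<rho>) / 2 - 1) * (sqrt (x * \<rho>) / (3 * C) - 1) \<le> real (nat A) * real (nat B)"
  proof (intro mult_mono A' B')
    show "0 \<le> sqrt (x * \<rho>) / (3 * C) - 1"
      using assms(7) C by (simp add: C_def[symmetric])
  qed auto
  also have "\<dots> \<le> real (card ?S)" using card by (metis of_nat_le_iff of_nat_mult)
  finally show ?thesis by (simp add: C_def)
qed

section \<open>Equidistribution among the residue classes\<close>

lemma card_eq_sum_residue_classes:
  assumes "finite S" "d \<ge> 1"
  shows "card S = (\<Sum>b\<in>{0..<int d}. card {n \<in> S. [n = b] (mod int d)})"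
proof -
  have "{n \<in> S. [n = b] (mod int d)} = {n \<in> S. n mod int d = b}" if "b \<in> {0..<int d}" for b
    using that by (auto simp: cong_def)
  then have "(\<Sum>b\<in>{0..<int d}. card {n \<in> S. [n = b] (mod int d)})
      = (\<Sum>b\<in>{0..<int d}. sum (\<lambda>_. 1) {n \<in> S. n mod int d = b})" by simp
  also have "\<dots> = sum (\<lambda>_. 1) S"
    using assms by (intro sum.group) auto
  finally show ?thesis by simp
qed

text \<open>Summing over all classes \<open>b\<close> turns the pairwise comparisons, used in both
  directions, into a comparison with the average.\<close>

lemma card_residue_class_bound:
  assumes "diophantine \<alpha> c" "d \<ge> 1" "0 \<le> u" "u + \<rho> \<le> 1" "\<rho> > 0" "x \<ge> 1"
  shows "\<bar>d * real (card {n \<in> bohr_interval_set \<alpha> x {u..u + \<rho>}. [n = a] (mod int d)})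
      - real (card (bohr_interval_set \<alpha> x {u..u + \<rho>}))\<bar>
    \<le> d * ((2 * d + 2 * (2 + d / c)) / c * sqrt (x * \<rho>) + 3)" (is "_ \<le> real d * ?E")
proof -
  let ?S = "bohr_interval_set \<alpha> x {u..u + \<rho>}"
  define N where "N b = real (card {n \<in> ?S. [n = b] (mod int d)})" for b
  have "real (card ?S) = (\<Sum>b\<in>{0..<int d}. N b)"
    using card_eq_sum_residue_classes[OF finite_bohr_interval_set assms(2)]
    by (simp add: N_def)
  then have "d * N a - real (card ?S) = (\<Sum>b\<in>{0..<int d}. N a - N b)"
    by (simp add: sum_subtractf)
  also have "\<bar>\<dots>\<bar> \<le> (\<Sum>b\<in>{0..<int d}. \<bar>N a - N b\<bar>)" by (rule sum_abs)
  also have "\<dots> \<le> (\<Sum>b\<in>{0..<int d}. ?E)"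
  proof (rule sum_mono)
    fix b
    show "\<bar>N a - N b\<bar> \<le> ?E"
      using card_residue_class_diff_le[OF assms, of a b] card_residue_class_diff_le[OF assms, of b a]
      unfolding N_def by linarith
  qed
  finally show ?thesis by (simp add: N_def)
qed

theorem theorem3:
  fixes \<alpha> :: real and \<rho> :: "nat \<Rightarrow> real" and I :: "nat \<Rightarrow> real set"
    and d :: nat and a :: int
  assumes "badly_approximable \<alpha>"
    and "\<And>x. x \<ge> 1 \<Longrightarrow> \<rho> x \<ge> 0"
    and "\<And>x. x \<ge> 1 \<Longrightarrow> I x = {0..\<rho> x} \<or> I x = {1 - \<rho> x..1}"
    and "\<And>x. x \<ge> 1 \<Longrightarrow> I x \<subseteq> {0..1}"
    and "filterlim (\<lambda>x. real x * \<rho> x) at_top sequentially"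
    and "d \<ge> 1"
  shows "(\<lambda>x. real (card {n \<in> bohr_interval_set \<alpha> x (I x). [n = a] (mod int d)})
              / real (card (bohr_interval_set \<alpha> x (I x))))
         \<longlonglongrightarrow> 1 / real d"
proof -
  obtain c where dio: "diophantine \<alpha> c"
    by (rule badly_approximable_imp_diophantine[OF assms(1)])
  have c: "c > 0" using dio diophantine_pos by blast
  define s where "s x = sqrt (real x * \<rho> x)" for x
  define K where "K = (2 * d + 2 * (2 + d / c)) / c"
  define C where "C = 3 * (2 + 1 / c)"
  have C: "C > 0" using c by (simp add: C_def add_pos_nonneg)
  define N where "N x = real (card (bohr_interval_set \<alpha> x (I x)))" for x
  define Na where "Na x = real (card {n \<in> bohr_interval_set \<alpha> x (I x). [n = a] (mod int d)})" for x
  have s: "filterlim s at_top sequentially"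
    unfolding s_def by (rule filterlim_compose[OF sqrt_at_top assms(5)])
  \<comment> \<open>With \<open>t = s x\<close>, the discrepancy is linear in \<open>t\<close> and
    the size of the Bohr set is at least quadratic.\<close>
  have lim: "((\<lambda>t. (K * t + 3) / ((t / 2 - 1) * (t / C - 1))) \<longlongrightarrow> 0) at_top"
    using C by real_asymp
  have "((\<lambda>x. Na x / N x - 1 / d) \<longlongrightarrow> 0) sequentially"
  proof (rule Lim_null_comparison[OF _ filterlim_compose[OF lim s]])
    have "eventually (\<lambda>x. s x > max 2 C) sequentially"
      using s unfolding filterlim_at_top_dense by blast
    then show "\<forall>\<^sub>F x in sequentially. norm (Na x / N x - 1 / d)
        \<le> (K * s x + 3) / ((s x / 2 - 1) * (s x / C - 1))"
      using eventually_ge_at_top[of 1]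
    proof eventually_elim
      case (elim x)
      have sx: "s x > 2" "s x > C" using elim by auto
      \<comment> \<open>Degenerate intervals are allowed by the hypotheses, but not once
        \<open>s x\<close> is positive.\<close>
      then have "\<rho> x \<noteq> 0" by (auto simp: s_def)
      with assms(2) elim have \<rho>: "\<rho> x > 0" by (simp add: order_less_le)
      \<comment> \<open>Both shapes of interval are covered at once, with \<open>u = 0\<close> or
        \<open>u = 1 - \<rho> x\<close>.\<close>
      obtain u where u: "I x = {u..u + \<rho> x}"
        using assms(3)[OF elim(2)] by (metis add.left_neutral diff_add_cancel)
      have "0 \<le> u" "u + \<rho> x \<le> 1" using assms(4)[OF elim(2)] \<rho> unfolding u by auto
      note 1 = card_residue_class_bound[OF dio assms(6) this \<rho> elim(2), of a]
        and 2 = card_bohr_interval_set_ge[OF dio this \<rho> elim(2)]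
      have 1: "\<bar>d * Na x - N x\<bar> \<le> d * (K * s x + 3)"
        using 1 by (simp add: Na_def N_def u K_def s_def)
      have 2: "(s x / 2 - 1) * (s x / C - 1) \<le> N x"
        using 2 sx by (simp add: N_def u C_def s_def)
      have pos: "(s x / 2 - 1) * (s x / C - 1) > 0" using sx C by simp
      then have N: "N x > 0" using 2 by simp
      have "norm (Na x / N x - 1 / d) = \<bar>(d * Na x - N x) / (d * N x)\<bar>"
        using N assms(6) by (simp add: field_simps)
      also have "\<dots> = \<bar>d * Na x - N x\<bar> / (d * N x)" using N by (simp add: abs_divide abs_mult)
      also have "\<dots> \<le> d * (K * s x + 3) / (d * N x)"
        using 1 N by (intro divide_right_mono) auto
      also have "\<dots> = (K * s x + 3) / N x" using assms(6) by simp
      also have "\<dots> \<le> (K * s x + 3) / ((s x / 2 - 1) * (s x / C - 1))"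
        using 2 pos N c sx by (intro divide_left_mono) (auto simp: K_def)
      finally show ?case .
    qed
  qed
  then have "(\<lambda>x. Na x / N x) \<longlonglongrightarrow> 1 / d" by (simp add: LIM_zero_iff)
  then show ?thesis by (simp add: Na_def N_def)
qed

end
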